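(* For every integer $n \geq 2$, let $G_n$ be the graph with vertex set $V(G_n) = \{u_0, \ldots, u_n\} \cup \{x_i, y_i, z_i : 1 \le i \le n-1\}$ (all these vertices distinct) and with exactly the following edges: $u_i u_{i+1}$ for $i \in \{0,\ldots,n-1\}$, and $u_i x_i$, $x_i y_i$, $y_i z_i$, $u_{i+1}x_i$, $u_{i+1}y_i$, $u_{i+1}z_i$ for $i \in \{1,\ldots,n-1\}$. Then $\gamma_{cg}(G_n) = n$.
   Context: The connected domination game on a graph $G$ is played by two players, Dominator and Staller, who alternately select vertices. A vertex $w$ is a legal move if (a) its closed neighborhood $N[w]$ contains at least one vertex not in the union of the closed neighborhoods of the previously selected vertices (i.e. it dominates a new vertex), and (b) unless it is the first move, $w$ is adjacent to at least one already selected vertex. The game ends when no legal move exists; on a connected graph the selected vertices then form a connected dominating set. Dominator wants to minimize the total number of moves, Staller wants to maximize it. $\gamma_{cg}(G)$ is the number of moves under optimal play when Dominator moves first (D-game). *)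

theory Defs
  imports "Graph_Theory.Graph_Theory"
begin

text \<open>
  A finite simple graph is a \<^locale>\<open>pair_graph\<close>: a symmetric, loop-free arc relation
  on a finite vertex set, so that an edge \<open>uv\<close> is the pair of arcs \<open>(u, v)\<close> and \<open>(v, u)\<close>.
\<close>

definition closed_nbhd :: "'a pair_pre_digraph \<Rightarrow> 'a \<Rightarrow> 'a set" where
  "closed_nbhd G w = insert w {v. (w, v) \<in> parcs G}"

text \<open>
  The legal moves depend on the previous moves only through the set \<open>S\<close> of selected vertices.
  A selected vertex is never legal again, since its closed neighborhood is already dominated.
\<close>

definition legal_moves :: "'a pair_pre_digraph \<Rightarrow> 'a set \<Rightarrow> 'a set" where
  "legal_moves G S = {w \<in> pverts G.
     \<not> closed_nbhd G w \<subseteq> (\<Union>s\<in>S. closed_nbhd G s) \<and>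
     (S \<noteq> {} \<longrightarrow> (\<exists>s\<in>S. (s, w) \<in> parcs G))}"

datatype player = Dominator | Staller

fun opponent :: "player \<Rightarrow> player" where
  "opponent Dominator = Staller"
| "opponent Staller = Dominator"

text \<open>
  The number of moves still to be made from the position \<open>S\<close> under optimal play with player \<open>p\<close>
  to move, by backward induction.  On an infinite graph the value is the dummy \<open>0\<close>; this only
  serves to make the recursion terminate.
\<close>

function remaining_moves :: "'a pair_pre_digraph \<Rightarrow> player \<Rightarrow> 'a set \<Rightarrow> nat" where
  "remaining_moves G p S =
     (if infinite (pverts G) \<or> legal_moves G S = {} then 0
      else case p of
        Dominator \<Rightarrow> 1 + Min ((\<lambda>w. remaining_moves G (opponent p) (insert w S)) ` legal_moves G S)
      | Staller \<Rightarrow> 1 + Max ((\<lambda>w. remaining_moves G (opponent p) (insert w S)) ` legal_moves G S))"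
  by pat_completeness auto
termination
proof -
  have decr: "card (pverts G - insert w S) < card (pverts G - S)"
    if "finite (pverts G)" "w \<in> legal_moves G S" for G :: "'a pair_pre_digraph" and S w
    using that by (intro psubset_card_mono) (auto simp: legal_moves_def)
  show ?thesis
    by (relation "measure (\<lambda>(G, p, S). card (pverts G - S))") (simp_all add: decr del: Diff_insert)
qed

declare remaining_moves.simps [simp del]

definition gamma_cg :: "'a pair_pre_digraph \<Rightarrow> nat" where
  "gamma_cg G = remaining_moves G Dominator {}"

datatype vertex = U nat | X nat | Y nat | Z nat

definition G_edges :: "nat \<Rightarrow> vertex rel" where
  "G_edges n =
     {(U i, U (i + 1)) | i. i \<in> {0..n - 1}} \<union>
     (\<Union>i\<in>{1..n - 1}. {(U i, X i), (X i, Y i), (Y i, Z i),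
       (U (i + 1), X i), (U (i + 1), Y i), (U (i + 1), Z i)})"

definition G_graph :: "nat \<Rightarrow> vertex pair_pre_digraph" where
  "G_graph n =
     \<lparr> pverts = U ` {0..n} \<union> X ` {1..n - 1} \<union> Y ` {1..n - 1} \<union> Z ` {1..n - 1},
       parcs = G_edges n \<union> (G_edges n)\<inverse> \<rparr>"

lemma pair_graph_G_graph:
  assumes "n \<ge> 2"
  shows "pair_graph (G_graph n)"
proof -
  have V: "finite (pverts (G_graph n))"
    by (simp add: G_graph_def)
  have E: "parcs (G_graph n) \<subseteq> pverts (G_graph n) \<times> pverts (G_graph n)"
    using assms by (auto simp: G_graph_def G_edges_def)
  have "symmetric (with_proj (G_graph n))"
    by (auto simp: symmetric_def G_graph_def intro: symI)
  moreover have "fst e \<noteq> snd e" if "e \<in> parcs (G_graph n)" for e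
    using that by (auto simp: G_graph_def G_edges_def)
  ultimately show ?thesis
    using V E by unfold_locales (auto intro: finite_subset)
qed

lemma connected_G_graph:
  assumes "n \<ge> 2"
  shows "connected (with_proj (G_graph n))"
proof -
  interpret pair_graph "G_graph n"
    using assms by (rule pair_graph_G_graph)
  let ?G = "with_proj (G_graph n)"
  have step: "a \<rightarrow>\<^sup>*\<^bsub>?G\<^esub> c" if "a \<rightarrow>\<^sup>*\<^bsub>?G\<^esub> b" "(b, c) \<in> parcs (G_graph n)" for a b c
    using that reachable_adj_trans by fastforce
  have u: "U 0 \<rightarrow>\<^sup>*\<^bsub>?G\<^esub> U i" if "i \<le> n" for i
    using that
  proof (induction i)
    case 0
    have "U 0 \<in> pverts (G_graph n)" by (simp add: G_graph_def)
    then show ?case by (simp add: reachable_refl)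
  next
    case (Suc i)
    have "(U i, U (Suc i)) \<in> parcs (G_graph n)"
      using Suc.prems by (auto simp: G_graph_def G_edges_def)
    with Suc show ?case by (auto intro: step)
  qed
  have "U 0 \<rightarrow>\<^sup>*\<^bsub>?G\<^esub> v" if v: "v \<in> pverts (G_graph n)" for v
  proof (cases "\<exists>i. v = U i")
    case True
    with v obtain i where "v = U i" "i \<le> n"
      by (auto simp: G_graph_def)
    then show ?thesis by (simp add: u)
  next
    case False
    with v obtain i where i: "i \<in> {1..n - 1}" "v \<in> {X i, Y i, Z i}"
      by (auto simp: G_graph_def)
    then have "(U (i + 1), v) \<in> parcs (G_graph n)"
      by (auto simp: G_graph_def G_edges_def)
    moreover have "U 0 \<rightarrow>\<^sup>*\<^bsub>?G\<^esub> U (i + 1)"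
      using i assms by (intro u) auto
    ultimately show ?thesis by (rule step[rotated])
  qed
  then have "a \<rightarrow>\<^sup>*\<^bsub>?G\<^esub> b" if "a \<in> pverts (G_graph n)" "b \<in> pverts (G_graph n)" for a b
    using that symmetric_reachable[OF sym_arcs] reachable_trans by blast
  moreover have "pverts (G_graph n) \<noteq> {}"
    by (simp add: G_graph_def)
  ultimately show ?thesis
    by (simp add: connected_def strongly_connected_def reachable_mk_symmetric_eq sym_arcs)
qed

end

theory Submission
  imports Defs
begin

text \<open>
  The sets \<open>{u\<^sub>0, u\<^sub>1}\<close> and \<open>{u\<^sub>i\<^sub>+\<^sub>1, y\<^sub>i, z\<^sub>i}\<close> for \<open>1 \<le> i \<le> n - 1\<close> are pairwise disjoint, and every
  dominating set meets each of them because it dominates \<open>u\<^sub>0\<close> and \<open>z\<^sub>i\<close>.  As the graph is connected,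
  the selected vertices dominate it at the end, so the game lasts at least \<open>n\<close> moves.  Conversely,
  if Dominator opens with \<open>u\<^sub>n\<close>, the rest of the game is forced to be \<open>u\<^sub>n\<^sub>-\<^sub>1, \<dots>, u\<^sub>1\<close>: once
  \<open>u\<^sub>k\<^sub>+\<^sub>1, \<dots>, u\<^sub>n\<close> are selected, their neighbors other than \<open>u\<^sub>k\<close> dominate nothing new.
\<close>

lemma remaining_moves_terminal:
  "legal_moves G S = {} \<Longrightarrow> remaining_moves G p S = 0"
  by (simp add: remaining_moves.simps)

text \<open>Minimum and maximum over finitely many moves are both attained, so either player's turn
  can be treated as one optimal move.\<close>

lemma remaining_moves_step:
  assumes "finite (pverts G)" "legal_moves G S \<noteq> {}"
  obtains w where "w \<in> legal_moves G S"
    "remaining_moves G p S = Suc (remaining_moves G (opponent p) (insert w S))"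
proof -
  let ?A = "(\<lambda>w. remaining_moves G (opponent p) (insert w S)) ` legal_moves G S"
  have fin: "finite ?A"
    using assms(1) by (simp add: legal_moves_def)
  have "\<exists>m\<in>?A. remaining_moves G p S = Suc m"
  proof (cases p)
    case Dominator
    with assms have "remaining_moves G p S = Suc (Min ?A)"
      by (subst remaining_moves.simps) simp
    with assms fin show ?thesis by (metis Min_in image_is_empty)
  next
    case Staller
    with assms have "remaining_moves G p S = Suc (Max ?A)"
      by (subst remaining_moves.simps) simp
    with assms fin show ?thesis by (metis Max_in image_is_empty)
  qed
  with that show thesis by blast
qed

lemma remaining_moves_Dominator_le:
  assumes "finite (pverts G)" "w \<in> legal_moves G S"
  shows "remaining_moves G Dominator S \<le> Suc (remaining_moves G Staller (insert w S))"
proof -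
  let ?A = "(\<lambda>w. remaining_moves G Staller (insert w S)) ` legal_moves G S"
  have "finite ?A"
    using assms(1) by (simp add: legal_moves_def)
  then have "Min ?A \<le> remaining_moves G Staller (insert w S)"
    using assms(2) by (intro Min_le) auto
  moreover have "remaining_moves G Dominator S = Suc (Min ?A)"
    using assms by (subst remaining_moves.simps) auto
  ultimately show ?thesis by simp
qed

lemma (in pair_graph) crossing_arc:
  assumes conn: "connected (with_proj G)"
    and A: "A \<subseteq> pverts G" "A \<noteq> {}" "A \<noteq> pverts G"
  obtains a b where "a \<in> A" "b \<in> pverts G - A" "(a, b) \<in> parcs G"
proof (rule ccontr)
  assume no_arc: "\<not> thesis"
  from A obtain a b where ab: "a \<in> A" "b \<in> pverts G" "b \<notin> A" by blast
  have "a \<rightarrow>\<^sup>*\<^bsub>with_proj G\<^esub> b"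
    using conn ab A(1)
    by (auto simp: connected_def strongly_connected_def reachable_mk_symmetric_eq sym_arcs)
  then have "b \<in> A"
  proof (induction rule: reachable_induct)
    case base
    show ?case using ab by simp
  next
    case (step x y)
    with no_arc that[of x y] in_arcsD2 show ?case by auto
  qed
  with ab show False by blast
qed

text \<open>Otherwise some arc leads from a dominated \<open>w\<close> to an undominated
  \<open>v\<close>. Then \<open>w\<close> is not selected, since \<open>v\<close> would be
  dominated; so \<open>w\<close> is adjacent to a selected vertex and is a legal move.\<close>

lemma (in pair_graph) terminal_imp_dominating:
  assumes conn: "connected (with_proj G)"
    and S: "S \<subseteq> pverts G" and terminal: "legal_moves G S = {}"
  shows "pverts G \<subseteq> (\<Union>s\<in>S. closed_nbhd G s)"
proof -
  let ?D = "\<Union>s\<in>S. closed_nbhd G s"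
  have D: "?D \<subseteq> pverts G"
    using S by (auto simp: closed_nbhd_def dest: in_arcsD2)
  show ?thesis
  proof (rule ccontr)
    assume not_dom: "\<not> pverts G \<subseteq> ?D"
    \<comment> \<open>In the empty position every vertex is a legal first move.\<close>
    have "S \<noteq> {}"
      using not_dom terminal by (auto simp: legal_moves_def closed_nbhd_def)
    then have "?D \<noteq> {}" by (auto simp: closed_nbhd_def)
    then obtain w v where wv: "w \<in> ?D" "v \<in> pverts G - ?D" "(w, v) \<in> parcs G"
      using crossing_arc[OF conn D] not_dom by blast
    then have "w \<in> legal_moves G S"
      using D by (auto simp: legal_moves_def closed_nbhd_def)
    with terminal show False by simp
  qed
qed

text \<open>No strategy is involved: each move adds one new vertex to \<open>S\<close>, and every
  play ends in a dominating set.\<close>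

lemma (in pair_graph) remaining_moves_ge:
  assumes conn: "connected (with_proj G)" and S: "S \<subseteq> pverts G"
    and min_dom: "\<And>D. D \<subseteq> pverts G \<Longrightarrow> pverts G \<subseteq> (\<Union>s\<in>D. closed_nbhd G s) \<Longrightarrow> k \<le> card D"
  shows "k \<le> remaining_moves G p S + card S"
  using S
proof (induction "card (pverts G - S)" arbitrary: p S rule: less_induct)
  case less
  show ?case
  proof (cases "legal_moves G S = {}")
    case True
    with conn less.prems show ?thesis
      by (intro trans_le_add2 min_dom terminal_imp_dominating)
  next
    case False
    then obtain w where w: "w \<in> legal_moves G S"
      and rem: "remaining_moves G p S = Suc (remaining_moves G (opponent p) (insert w S))"
      using remaining_moves_step pair_finite_verts by metis
    from w have wV: "w \<in> pverts G" and wS: "w \<notin> S"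
      by (auto simp: legal_moves_def)
    have "card (pverts G - insert w S) < card (pverts G - S)"
      using wV wS by (intro psubset_card_mono) auto
    then have "k \<le> remaining_moves G (opponent p) (insert w S) + card (insert w S)"
      using less wV by simp
    moreover have "finite S"
      using less.prems finite_subset pair_finite_verts by blast
    ultimately show ?thesis using rem wS by simp
  qed
qed

text \<open>Truncated subtraction puts \<open>U 0\<close> and \<open>U 1\<close> together in block
  0; for \<open>i\<close> \<ge> 1, \<open>U (i + 1)\<close> shares block \<open>i\<close> with
  \<open>Y i\<close> and \<open>Z i\<close>.\<close>

fun block :: "vertex \<Rightarrow> nat" where
  "block (U i) = i - 1"
| "block (X i) = i"
| "block (Y i) = i"
| "block (Z i) = i"

lemma card_dominating_G_graph:
  assumes n: "n \<ge> 2" and D: "D \<subseteq> pverts (G_graph n)"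
    and dom: "pverts (G_graph n) \<subseteq> (\<Union>s\<in>D. closed_nbhd (G_graph n) s)"
  shows "n \<le> card D"
proof -
  have "finite D"
    using D by (rule finite_subset) (simp add: G_graph_def)
  have "i \<in> block ` D" if "i < n" for i
  proof (cases "i = 0")
    case True
    have "U 0 \<in> pverts (G_graph n)" by (simp add: G_graph_def)
    with dom obtain s where s: "s \<in> D" "U 0 \<in> closed_nbhd (G_graph n) s" by blast
    then have "block s = i"
      using True by (auto simp: closed_nbhd_def G_graph_def G_edges_def)
    with s show ?thesis by blast
  next
    case False
    with that have "Z i \<in> pverts (G_graph n)" by (auto simp: G_graph_def)
    with dom obtain s where s: "s \<in> D" "Z i \<in> closed_nbhd (G_graph n) s" by blast
    then have "block s = i"
      by (auto simp: closed_nbhd_def G_graph_def G_edges_def)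
    with s show ?thesis by blast
  qed
  \<comment> \<open>The closed neighborhoods of \<open>U 0\<close> and of each \<open>Z i\<close>
    lie within a single block, so \<open>D\<close> meets all \<open>n\<close> blocks.\<close>
  then have "{..<n} \<subseteq> block ` D" by auto
  with \<open>finite D\<close> show ?thesis
    by (metis card_lessThan surj_card_le)
qed

text \<open>Chosen so that every vertex of index \<open>i\<close> < \<open>n\<close> in the graph is
  adjacent to \<open>U (i + 1)\<close>.\<close>

fun index :: "vertex \<Rightarrow> nat" where
  "index (U i) = i"
| "index (X i) = i"
| "index (Y i) = i"
| "index (Z i) = i"

lemma suffix_dominates:
  assumes k: "k < n" and v: "v \<in> pverts (G_graph n)" "k \<le> index v"
  shows "v \<in> (\<Union>s\<in>U ` {Suc k..n}. closed_nbhd (G_graph n) s)"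
proof (cases "\<exists>i. v = U i \<and> k < i")
  case True
  then show ?thesis using v by (auto simp: closed_nbhd_def G_graph_def)
next
  case False
  with k v have "v \<in> closed_nbhd (G_graph n) (U (Suc (index v)))" "index v < n"
    by (auto simp: closed_nbhd_def G_graph_def G_edges_def)
  with v(2) show ?thesis by auto
qed

lemma legal_moves_suffix:
  assumes "k < n"
  shows "legal_moves (G_graph n) (U ` {Suc k..n}) \<subseteq> (if k = 0 then {} else {U k})"
proof
  let ?S = "U ` {Suc k..n}"
  fix w assume w: "w \<in> legal_moves (G_graph n) ?S"
  then have "\<exists>j. k < j \<and> j \<le> n \<and> (U j, w) \<in> parcs (G_graph n)"
    using assms by (auto simp: legal_moves_def Suc_le_eq)
  then obtain j where j: "k < j" "j \<le> n" "(U j, w) \<in> parcs (G_graph n)"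
    by blast
  from w have wV: "w \<in> pverts (G_graph n)" by (simp add: legal_moves_def)
  have nbhd: "closed_nbhd (G_graph n) w \<subseteq> pverts (G_graph n)"
    using wV assms by (auto simp: closed_nbhd_def G_graph_def G_edges_def)
  have "\<not> closed_nbhd (G_graph n) w \<subseteq> (\<Union>s\<in>?S. closed_nbhd (G_graph n) s)"
    using w by (simp add: legal_moves_def)
  then obtain v where "v \<in> closed_nbhd (G_graph n) w" "index v < k"
    using suffix_dominates[OF assms] nbhd by (meson not_le subset_iff)
  \<comment> \<open>Only \<open>U k\<close> is adjacent to some \<open>U j\<close> with
    \<open>j\<close> > \<open>k\<close> and also to a vertex of index below \<open>k\<close>; for
    \<open>k\<close> = 0 there is no such index.\<close>
  then show "w \<in> (if k = 0 then {} else {U k})"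
    using j by (auto simp: closed_nbhd_def G_graph_def G_edges_def)
qed

text \<open>At most one move is legal, whoever plays, and it extends the selected suffix by one
  vertex; hence the induction for arbitrary \<open>p\<close>.\<close>

lemma remaining_moves_suffix:
  assumes "k < n"
  shows "remaining_moves (G_graph n) p (U ` {Suc k..n}) \<le> k"
  using assms
proof (induction k arbitrary: p)
  case 0
  then have "legal_moves (G_graph n) (U ` {Suc 0..n}) = {}"
    using legal_moves_suffix[of 0 n] by simp
  then show ?case by (simp add: remaining_moves_terminal)
next
  case (Suc k)
  let ?S = "U ` {Suc (Suc k)..n}"
  show ?case
  proof (cases "legal_moves (G_graph n) ?S = {}")
    case True
    then show ?thesis by (simp add: remaining_moves_terminal)
  next
    case False
    moreover have "finite (pverts (G_graph n))"
      by (simp add: G_graph_def)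
    ultimately obtain w where "w \<in> legal_moves (G_graph n) ?S"
      and rem: "remaining_moves (G_graph n) p ?S =
        Suc (remaining_moves (G_graph n) (opponent p) (insert w ?S))"
      using remaining_moves_step by metis
    then have "w = U (Suc k)"
      using legal_moves_suffix[OF Suc.prems] by auto
    then have "insert w ?S = U ` {Suc k..n}"
      using Suc.prems by (simp add: atLeastAtMost_insertL flip: image_insert)
    with rem Suc show ?thesis by simp
  qed
qed

theorem lemma3p3:
  fixes n :: nat
  assumes "n \<ge> 2"
  shows "gamma_cg (G_graph n) = n"
proof (rule antisym)
  have "U n \<in> legal_moves (G_graph n) {}"
    by (auto simp: legal_moves_def closed_nbhd_def G_graph_def)
  then have "gamma_cg (G_graph n) \<le> Suc (remaining_moves (G_graph n) Staller {U n})"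
    unfolding gamma_cg_def by (intro remaining_moves_Dominator_le) (simp add: G_graph_def)
  \<comment> \<open>After the opening the selected set is the suffix for \<open>k\<close> =
    \<open>n - 1\<close>.\<close>
  also have "remaining_moves (G_graph n) Staller {U n} \<le> n - 1"
    using remaining_moves_suffix[of "n - 1" n Staller] assms by simp
  finally show "gamma_cg (G_graph n) \<le> n" using assms by simp
next
  interpret pair_graph "G_graph n"
    using assms by (rule pair_graph_G_graph)
  show "n \<le> gamma_cg (G_graph n)"
    using remaining_moves_ge[OF connected_G_graph[OF assms], of "{}" n Dominator]
      card_dominating_G_graph[OF assms]
    by (simp add: gamma_cg_def)
qed

end
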